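(* Let $(M,\phi,\xi,\eta,g)$ be an almost contact metric manifold, let $(M_1,g_1,J_1)$ be a metallic Riemannian manifold, and let $F:M\to M_1$ be a smooth map such that $F_*\phi=J_1F_*$. Then $F$ is a constant map.
   Context: All manifolds and maps are $C^\infty$; $F_*$ is the differential of $F$. A metallic Riemannian manifold $(\tilde M,\tilde g,J)$ is a Riemannian manifold $(\tilde M,\tilde g)$ with a $(1,1)$-tensor field $J$ such that $J^2=pJ+qI$ for some positive integers $p,q$ ($I$ the identity) and $\tilde g(JX,Y)=\tilde g(X,JY)$ for all vector fields $X,Y$; it is assumed throughout that $\nabla J=0$ for the Levi-Civita connection $\nabla$ of $\tilde g$. An almost contact metric manifold $(M,\phi,\xi,\eta,g)$ is a $(2n+1)$-dimensional manifold $M$ with a $(1,1)$-tensor field $\phi$, a vector field $\xi$, a $1$-form $\eta$ and a Riemannian metric $g$ such that $\phi^2=-I+\eta\otimes\xi$, $\phi\xi=0$, $\eta\circ\phi=0$, $\eta(\xi)=1$, $g(\phi X,\phi Y)=g(X,Y)-\eta(X)\eta(Y)$ and $\eta(X)=g(X,\xi)$ for all vector fields $X,Y$.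
   Formalization: M is assumed connected: otherwise the claim is false (a map taking different constant values on two components has zero differential and satisfies F_*φ = J₁F_* ); M₁ is taken to have dimension at least 1, excluding only the degenerate zero-dimensional target. *)

theory Defs
  imports "HOL-Analysis.Analysis" "HOL-Library.Function_Algebras"
begin

section \<open>Smooth maps between Euclidean spaces\<close>

text \<open>The two predicates below are meant for open sets \<open>S\<close>.\<close>

primrec higher_differentiable_on ::
  "'a::real_normed_vector set \<Rightarrow> ('a \<Rightarrow> 'b::real_normed_vector) \<Rightarrow> nat \<Rightarrow> bool" where
  "higher_differentiable_on S f 0 \<longleftrightarrow> continuous_on S f"
| "higher_differentiable_on S f (Suc n) \<longleftrightarrow>
     (\<forall>x\<in>S. f differentiable (at x)) \<and>
     (\<forall>v. higher_differentiable_on S (\<lambda>x. frechet_derivative f (at x) v) n)"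

definition smooth_on :: "'a::real_normed_vector set \<Rightarrow> ('a \<Rightarrow> 'b::real_normed_vector) \<Rightarrow> bool" where
  "smooth_on S f \<longleftrightarrow> (\<forall>n. higher_differentiable_on S f n)"

section \<open>Smooth manifolds\<close>

text \<open>The underlying topological space of a manifold is a Hausdorff, second countable type
  \<open>'a\<close>; the manifold is modelled on the Euclidean space \<open>'e\<close>, so its dimension is
  \<open>DIM('e) \<ge> 1\<close>. An atlas is a set of charts \<open>(U, c)\<close>, where \<open>U\<close> is the domain of \<open>c\<close>. It need not
  be maximal. Connectedness is not part of the definition.\<close>

type_synonym ('a, 'e) atlas = "('a set \<times> ('a \<Rightarrow> 'e)) set"

definition chart :: "'a::topological_space set \<Rightarrow> ('a \<Rightarrow> 'e::euclidean_space) \<Rightarrow> bool" where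
  "chart U c \<longleftrightarrow> open U \<and> open (c ` U) \<and> homeomorphism U (c ` U) c (inv_into U c)"

definition smooth_manifold ::
  "('a::{t2_space, second_countable_topology}, 'e::euclidean_space) atlas \<Rightarrow> bool" where
  "smooth_manifold M \<longleftrightarrow>
     (\<forall>(U, c)\<in>M. chart U c) \<and>
     (\<Union>(U, c)\<in>M. U) = UNIV \<and>
     (\<forall>(U, c)\<in>M. \<forall>(V, d)\<in>M. smooth_on (c ` (U \<inter> V)) (d \<circ> inv_into U c))"

definition smooth_fun :: "('a, 'e::euclidean_space) atlas \<Rightarrow> ('a \<Rightarrow> real) \<Rightarrow> bool" where
  "smooth_fun M f \<longleftrightarrow> (\<forall>(U, c)\<in>M. smooth_on (c ` U) (f \<circ> inv_into U c))"

definition smooth_map ::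
  "('a::topological_space, 'e::euclidean_space) atlas \<Rightarrow>
   ('b::topological_space, 'f::euclidean_space) atlas \<Rightarrow> ('a \<Rightarrow> 'b) \<Rightarrow> bool" where
  "smooth_map M N F \<longleftrightarrow>
     continuous_on UNIV F \<and>
     (\<forall>(U, c)\<in>M. \<forall>(V, d)\<in>N. smooth_on (c ` (U \<inter> F -` V)) (d \<circ> F \<circ> inv_into U c))"

section \<open>Tangent vectors and tensor fields\<close>

instantiation "fun" :: (type, real_vector) real_vector
begin

definition scaleR_fun :: "real \<Rightarrow> ('a \<Rightarrow> 'b) \<Rightarrow> 'a \<Rightarrow> 'b" where
  "scaleR_fun r f = (\<lambda>x. r *\<^sub>R f x)"

instance
  by standard (simp_all add: fun_eq_iff scaleR_fun_def scaleR_add_right scaleR_add_left)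

end

text \<open>A tangent vector at \<open>x\<close> is a derivation at \<open>x\<close> of the algebra of smooth real functions.
  All operations on functions are pointwise. A derivation is extended by 0 to the non-smooth
  functions, so that derivations that agree on smooth functions are equal.\<close>

type_synonym 'a tangent_vec = "('a \<Rightarrow> real) \<Rightarrow> real"

type_synonym 'a vec_field = "'a \<Rightarrow> 'a tangent_vec"

definition tangent_space :: "('a, 'e::euclidean_space) atlas \<Rightarrow> 'a \<Rightarrow> 'a tangent_vec set" where
  "tangent_space M x =
     {v. (\<forall>f g. smooth_fun M f \<longrightarrow> smooth_fun M g \<longrightarrow> v (f + g) = v f + v g) \<and>
         (\<forall>r f. smooth_fun M f \<longrightarrow> v (r *\<^sub>R f) = r * v f) \<and>
         (\<forall>f g. smooth_fun M f \<longrightarrow> smooth_fun M g \<longrightarrow> v (f * g) = f x * v g + g x * v f) \<and>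
         (\<forall>f. \<not> smooth_fun M f \<longrightarrow> v f = 0)}"

text \<open>The differential \<open>F\<^sub>*\<close> of a smooth map \<open>F\<close> into \<open>N\<close>.\<close>

definition differential ::
  "('b, 'f::euclidean_space) atlas \<Rightarrow> ('a \<Rightarrow> 'b) \<Rightarrow> 'a tangent_vec \<Rightarrow> 'b tangent_vec" where
  "differential N F v = (\<lambda>h. if smooth_fun N h then v (h \<circ> F) else 0)"

definition smooth_vector_field :: "('a, 'e::euclidean_space) atlas \<Rightarrow> 'a vec_field \<Rightarrow> bool" where
  "smooth_vector_field M X \<longleftrightarrow>
     (\<forall>x. X x \<in> tangent_space M x) \<and>
     (\<forall>f. smooth_fun M f \<longrightarrow> smooth_fun M (\<lambda>x. X x f))"

definition linear_on_tangent ::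
  "('a, 'e::euclidean_space) atlas \<Rightarrow> 'a \<Rightarrow> ('a tangent_vec \<Rightarrow> 'v::real_vector) \<Rightarrow> bool" where
  "linear_on_tangent M x L \<longleftrightarrow>
     (\<forall>v\<in>tangent_space M x. \<forall>w\<in>tangent_space M x. \<forall>a b.
        L (a *\<^sub>R v + b *\<^sub>R w) = a *\<^sub>R L v + b *\<^sub>R L w)"

text \<open>Tensor fields are given pointwise; their values outside the tangent spaces are irrelevant.
  By the existence of bump functions it suffices to test smoothness on global vector fields.\<close>

definition one_form ::
  "('a, 'e::euclidean_space) atlas \<Rightarrow> ('a \<Rightarrow> 'a tangent_vec \<Rightarrow> real) \<Rightarrow> bool" where
  "one_form M \<eta> \<longleftrightarrow>
     (\<forall>x. linear_on_tangent M x (\<eta> x)) \<and>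
     (\<forall>X. smooth_vector_field M X \<longrightarrow> smooth_fun M (\<lambda>x. \<eta> x (X x)))"

definition tensor_field_1_1 ::
  "('a, 'e::euclidean_space) atlas \<Rightarrow> ('a \<Rightarrow> 'a tangent_vec \<Rightarrow> 'a tangent_vec) \<Rightarrow> bool" where
  "tensor_field_1_1 M T \<longleftrightarrow>
     (\<forall>x. T x ` tangent_space M x \<subseteq> tangent_space M x \<and> linear_on_tangent M x (T x)) \<and>
     (\<forall>X. smooth_vector_field M X \<longrightarrow> smooth_vector_field M (\<lambda>x. T x (X x)))"

section \<open>Riemannian metrics and the Levi-Civita connection\<close>

definition riemannian_metric ::
  "('a, 'e::euclidean_space) atlas \<Rightarrow> ('a \<Rightarrow> 'a tangent_vec \<Rightarrow> 'a tangent_vec \<Rightarrow> real) \<Rightarrow> bool" where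
  "riemannian_metric M g \<longleftrightarrow>
     (\<forall>x. \<forall>v\<in>tangent_space M x. linear_on_tangent M x (g x v)) \<and>
     (\<forall>x. \<forall>v\<in>tangent_space M x. \<forall>w\<in>tangent_space M x. g x v w = g x w v) \<and>
     (\<forall>x. \<forall>v\<in>tangent_space M x. v \<noteq> 0 \<longrightarrow> g x v v > 0) \<and>
     (\<forall>X Y. smooth_vector_field M X \<longrightarrow> smooth_vector_field M Y \<longrightarrow>
        smooth_fun M (\<lambda>x. g x (X x) (Y x)))"

definition riemannian_manifold ::
  "('a::{t2_space, second_countable_topology}, 'e::euclidean_space) atlas \<Rightarrow>
   ('a \<Rightarrow> 'a tangent_vec \<Rightarrow> 'a tangent_vec \<Rightarrow> real) \<Rightarrow> bool" where
  "riemannian_manifold M g \<longleftrightarrow> smooth_manifold M \<and> riemannian_metric M g"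

definition lie_bracket :: "'a vec_field \<Rightarrow> 'a vec_field \<Rightarrow> 'a vec_field" where
  "lie_bracket X Y = (\<lambda>x f. X x (\<lambda>y. Y y f) - Y x (\<lambda>y. X y f))"

text \<open>\<open>D X Y\<close> is the covariant derivative of \<open>Y\<close> in direction \<open>X\<close>; only its values on smooth
  vector fields matter.\<close>

definition affine_connection ::
  "('a, 'e::euclidean_space) atlas \<Rightarrow> ('a vec_field \<Rightarrow> 'a vec_field \<Rightarrow> 'a vec_field) \<Rightarrow> bool" where
  "affine_connection M D \<longleftrightarrow>
     (\<forall>X Y. smooth_vector_field M X \<longrightarrow> smooth_vector_field M Y \<longrightarrow>
        smooth_vector_field M (D X Y)) \<and>
     (\<forall>X X' Y. smooth_vector_field M X \<longrightarrow> smooth_vector_field M X' \<longrightarrow>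
        smooth_vector_field M Y \<longrightarrow> D (X + X') Y = D X Y + D X' Y) \<and>
     (\<forall>f X Y. smooth_fun M f \<longrightarrow> smooth_vector_field M X \<longrightarrow> smooth_vector_field M Y \<longrightarrow>
        D (\<lambda>x. f x *\<^sub>R X x) Y = (\<lambda>x. f x *\<^sub>R D X Y x)) \<and>
     (\<forall>X Y Y'. smooth_vector_field M X \<longrightarrow> smooth_vector_field M Y \<longrightarrow>
        smooth_vector_field M Y' \<longrightarrow> D X (Y + Y') = D X Y + D X Y') \<and>
     (\<forall>f X Y. smooth_fun M f \<longrightarrow> smooth_vector_field M X \<longrightarrow> smooth_vector_field M Y \<longrightarrow>
        D X (\<lambda>x. f x *\<^sub>R Y x) = (\<lambda>x. X x f *\<^sub>R Y x + f x *\<^sub>R D X Y x))"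

definition levi_civita_connection ::
  "('a, 'e::euclidean_space) atlas \<Rightarrow> ('a \<Rightarrow> 'a tangent_vec \<Rightarrow> 'a tangent_vec \<Rightarrow> real) \<Rightarrow>
   ('a vec_field \<Rightarrow> 'a vec_field \<Rightarrow> 'a vec_field) \<Rightarrow> bool" where
  "levi_civita_connection M g D \<longleftrightarrow>
     affine_connection M D \<and>
     (\<forall>X Y. smooth_vector_field M X \<longrightarrow> smooth_vector_field M Y \<longrightarrow>
        D X Y - D Y X = lie_bracket X Y) \<and>
     (\<forall>X Y Z. smooth_vector_field M X \<longrightarrow> smooth_vector_field M Y \<longrightarrow>
        smooth_vector_field M Z \<longrightarrow>
        (\<forall>x. X x (\<lambda>y. g y (Y y) (Z y)) = g x (D X Y x) (Z x) + g x (Y x) (D X Z x)))"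

text \<open>The covariant derivative of a (1,1)-tensor field,
  \<open>(\<nabla>\<^sub>X T) Y = \<nabla>\<^sub>X (T Y) - T (\<nabla>\<^sub>X Y)\<close>.\<close>

definition cov_deriv_1_1 ::
  "('a vec_field \<Rightarrow> 'a vec_field \<Rightarrow> 'a vec_field) \<Rightarrow>
   ('a \<Rightarrow> 'a tangent_vec \<Rightarrow> 'a tangent_vec) \<Rightarrow> 'a vec_field \<Rightarrow> 'a vec_field \<Rightarrow> 'a vec_field" where
  "cov_deriv_1_1 D T X Y = (\<lambda>x. D X (\<lambda>y. T y (Y y)) x - T x (D X Y x))"

definition parallel_1_1 ::
  "('a, 'e::euclidean_space) atlas \<Rightarrow> ('a vec_field \<Rightarrow> 'a vec_field \<Rightarrow> 'a vec_field) \<Rightarrow>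
   ('a \<Rightarrow> 'a tangent_vec \<Rightarrow> 'a tangent_vec) \<Rightarrow> bool" where
  "parallel_1_1 M D T \<longleftrightarrow>
     (\<forall>X Y. smooth_vector_field M X \<longrightarrow> smooth_vector_field M Y \<longrightarrow> cov_deriv_1_1 D T X Y = 0)"

section \<open>Metallic Riemannian and almost contact metric manifolds\<close>

text \<open>By the fundamental theorem of Riemannian geometry a Levi-Civita connection exists and is
  determined on smooth vector fields, so the last conjunct says \<open>\<nabla>J = 0\<close> for this connection.\<close>

definition metallic_riemannian_manifold ::
  "('a::{t2_space, second_countable_topology}, 'e::euclidean_space) atlas \<Rightarrow>
   ('a \<Rightarrow> 'a tangent_vec \<Rightarrow> 'a tangent_vec \<Rightarrow> real) \<Rightarrow>
   ('a \<Rightarrow> 'a tangent_vec \<Rightarrow> 'a tangent_vec) \<Rightarrow> bool" where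
  "metallic_riemannian_manifold M g J \<longleftrightarrow>
     riemannian_manifold M g \<and>
     tensor_field_1_1 M J \<and>
     (\<exists>p q::nat. p > 0 \<and> q > 0 \<and>
        (\<forall>x. \<forall>v\<in>tangent_space M x. J x (J x v) = real p *\<^sub>R J x v + real q *\<^sub>R v)) \<and>
     (\<forall>x. \<forall>v\<in>tangent_space M x. \<forall>w\<in>tangent_space M x. g x (J x v) w = g x v (J x w)) \<and>
     (\<exists>D. levi_civita_connection M g D \<and> parallel_1_1 M D J)"

definition almost_contact_metric_manifold ::
  "('a::{t2_space, second_countable_topology}, 'e::euclidean_space) atlas \<Rightarrow>
   ('a \<Rightarrow> 'a tangent_vec \<Rightarrow> 'a tangent_vec) \<Rightarrow> 'a vec_field \<Rightarrow>
   ('a \<Rightarrow> 'a tangent_vec \<Rightarrow> real) \<Rightarrow>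
   ('a \<Rightarrow> 'a tangent_vec \<Rightarrow> 'a tangent_vec \<Rightarrow> real) \<Rightarrow> bool" where
  "almost_contact_metric_manifold M \<phi> \<xi> \<eta> g \<longleftrightarrow>
     riemannian_manifold M g \<and>
     (\<exists>n::nat. DIM('e) = 2 * n + 1) \<and>
     tensor_field_1_1 M \<phi> \<and> smooth_vector_field M \<xi> \<and> one_form M \<eta> \<and>
     (\<forall>x. \<forall>v\<in>tangent_space M x. \<phi> x (\<phi> x v) = - v + \<eta> x v *\<^sub>R \<xi> x) \<and>
     (\<forall>x. \<phi> x (\<xi> x) = 0) \<and>
     (\<forall>x. \<forall>v\<in>tangent_space M x. \<eta> x (\<phi> x v) = 0) \<and>
     (\<forall>x. \<eta> x (\<xi> x) = 1) \<and>
     (\<forall>x. \<forall>v\<in>tangent_space M x. \<forall>w\<in>tangent_space M x.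
        g x (\<phi> x v) (\<phi> x w) = g x v w - \<eta> x v * \<eta> x w) \<and>
     (\<forall>x. \<forall>v\<in>tangent_space M x. \<eta> x v = g x v (\<xi> x))"

end

theory Submission
  imports Defs
begin

text \<open>The relations \<open>J\<^sub>1\<^sup>2 = pJ\<^sub>1 + qI\<close> with \<open>q > 0\<close> make \<open>J\<^sub>1\<close> injective, so \<open>\<phi>\<xi> = 0\<close> gives
  \<open>F\<^sub>*\<xi> = 0\<close>, and \<open>w = F\<^sub>*v\<close> satisfies \<open>J\<^sub>1\<^sup>2w = -w\<close>. Hence \<open>pJ\<^sub>1w = -(q + 1)w\<close>; applying \<open>J\<^sub>1\<close> once
  more yields \<open>(p\<^sup>2 + (q + 1)\<^sup>2)w = 0\<close>, so \<open>F\<^sub>* = 0\<close>. To conclude without local coordinates of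
  \<open>F\<close>, compose \<open>F\<close> with a bump function \<open>h\<close> on the target that attains the value \<open>h (F x)\<close> only
  at \<open>F x\<close>: then \<open>h \<circ> F\<close> has vanishing differential, is constant by connectedness, and \<open>F\<close> never
  leaves \<open>F x\<close>.\<close>

section \<open>Calculus of smooth functions\<close>

text \<open>A Frechet derivative depends only on the germ of the function, and openness of
  \<open>S\<close> makes agreement on \<open>S\<close> agreement near each of its points.\<close>

lemma higher_differentiable_on_cong:
  assumes "open S" "\<And>x. x \<in> S \<Longrightarrow> f x = g x" "higher_differentiable_on S f n"
  shows "higher_differentiable_on S g n"
  using assms(2,3)
proof (induction n arbitrary: f g)
  case 0
  then show ?case using continuous_on_cong by force
next
  case (Suc n)
  have D: "(g has_derivative frechet_derivative f (at x)) (at x)" if "x \<in> S" for x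
    using Suc.prems(2) that Suc.prems(1)
    by (auto simp: frechet_derivative_works
        intro: has_derivative_transform_within_open[OF _ assms(1) that])
  have "frechet_derivative f (at x) v = frechet_derivative g (at x) v" if "x \<in> S" for x v
    using frechet_derivative_at[OF D[OF that]] by simp
  then have "higher_differentiable_on S (\<lambda>x. frechet_derivative g (at x) v) n" for v
    using Suc.IH[of "\<lambda>x. frechet_derivative f (at x) v" "\<lambda>x. frechet_derivative g (at x) v"]
      Suc.prems(2) by simp
  then show ?case using D by (auto simp: differentiable_def)
qed

text \<open>Derivatives are unique, so an explicit family \<open>f'\<close>, as produced by the
  differentiation rules, may replace \<open>frechet_derivative\<close>.\<close>

lemma higher_differentiable_on_SucI:
  assumes "open S" "\<And>x. x \<in> S \<Longrightarrow> (f has_derivative f' x) (at x)"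
    and "\<And>v. higher_differentiable_on S (\<lambda>x. f' x v) n"
  shows "higher_differentiable_on S f (Suc n)"
proof -
  have "f' x = frechet_derivative f (at x)" if "x \<in> S" for x
    using frechet_derivative_at[OF assms(2)[OF that]] .
  then have "higher_differentiable_on S (\<lambda>x. frechet_derivative f (at x) v) n" for v
    using assms(3)[of v] by (rule_tac higher_differentiable_on_cong[OF assms(1)]) auto
  then show ?thesis using assms(2) by (auto simp: differentiable_def)
qed

lemma higher_differentiable_on_SucD:
  assumes "higher_differentiable_on S f (Suc n)"
  shows "x \<in> S \<Longrightarrow> (f has_derivative frechet_derivative f (at x)) (at x)"
    and "higher_differentiable_on S (\<lambda>x. frechet_derivative f (at x) v) n"
  using assms by (auto simp: frechet_derivative_works)

lemma higher_differentiable_on_lower: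
  "higher_differentiable_on S f (Suc n) \<Longrightarrow> higher_differentiable_on S f n"
proof (induction n arbitrary: f)
  case 0
  then show ?case
    by (auto intro!: continuous_at_imp_continuous_on differentiable_imp_continuous_within)
next
  case (Suc n)
  from Suc.prems have "higher_differentiable_on S (\<lambda>x. frechet_derivative f (at x) v) n" for v
    by (intro Suc.IH) (simp del: higher_differentiable_on.simps add: higher_differentiable_on_SucD)
  with Suc.prems show ?case by simp
qed

text \<open>Differentiability is tested in full neighbourhoods, hence point by point; only the
  continuity at order 0 uses that the pieces are open.\<close>

lemma higher_differentiable_on_Union:
  "(\<And>A. A \<in> \<A> \<Longrightarrow> open A) \<Longrightarrow> (\<And>A. A \<in> \<A> \<Longrightarrow> higher_differentiable_on A f n) \<Longrightarrow>
    higher_differentiable_on (\<Union>\<A>) f n"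
proof (induction n arbitrary: f)
  case 0
  then show ?case using continuous_on_open_Union by auto
qed auto

section \<open>Closure under sums, bilinear products and composition\<close>

lemma higher_differentiable_on_const:
  "higher_differentiable_on S (\<lambda>x. c) n"
  by (induction n arbitrary: c) auto

lemma higher_differentiable_on_id:
  "open S \<Longrightarrow> higher_differentiable_on S (\<lambda>x. x) n"
  by (cases n) (auto intro!: continuous_on_id higher_differentiable_on_const
      higher_differentiable_on_SucI[where f' = "\<lambda>x v. v"] simp del: higher_differentiable_on.simps(2))

lemma higher_differentiable_on_add:
  assumes "open S"
  shows "higher_differentiable_on S f n \<Longrightarrow> higher_differentiable_on S g n \<Longrightarrow>
    higher_differentiable_on S (\<lambda>x. f x + g x) n"
proof (induction n arbitrary: f g)
  case 0
  then show ?case by (auto intro: continuous_on_add)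
next
  case (Suc n)
  note D = higher_differentiable_on_SucD[OF Suc.prems(1)] higher_differentiable_on_SucD[OF Suc.prems(2)]
  show ?case
    by (rule higher_differentiable_on_SucI[OF assms has_derivative_add[OF D(1) D(3)]])
      (auto intro: Suc.IH D)
qed

lemma higher_differentiable_on_sum:
  assumes "open S" "finite A" "\<And>i. i \<in> A \<Longrightarrow> higher_differentiable_on S (f i) n"
  shows "higher_differentiable_on S (\<lambda>x. \<Sum>i\<in>A. f i x) n"
  using assms(2,3)
  by (induction A rule: finite_induct)
    (auto intro: higher_differentiable_on_const higher_differentiable_on_add[OF assms(1)])

text \<open>The product rule pairs the derivative of one factor with the other factor itself; the
  latter has to be lowered to order \<open>n\<close> for the induction hypothesis.\<close>

lemma (in bounded_bilinear) higher_differentiable_on: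
  assumes "open S"
  shows "higher_differentiable_on S f n \<Longrightarrow> higher_differentiable_on S g n \<Longrightarrow>
    higher_differentiable_on S (\<lambda>x. prod (f x) (g x)) n"
proof (induction n arbitrary: f g)
  case 0
  then show ?case by (auto intro: continuous_on)
next
  case (Suc n)
  note D = higher_differentiable_on_SucD[OF Suc.prems(1)] higher_differentiable_on_SucD[OF Suc.prems(2)]
  note L = higher_differentiable_on_lower[OF Suc.prems(1)] higher_differentiable_on_lower[OF Suc.prems(2)]
  show ?case
    by (rule higher_differentiable_on_SucI[OF assms FDERIV[OF D(1) D(3)]])
      (auto intro!: Suc.IH D L higher_differentiable_on_add[OF assms])
qed

lemmas higher_differentiable_on_mult = bounded_bilinear.higher_differentiable_on[OF bounded_bilinear_mult]
  and higher_differentiable_on_scaleR = bounded_bilinear.higher_differentiable_on[OF bounded_bilinear_scaleR]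
  and higher_differentiable_on_inner = bounded_bilinear.higher_differentiable_on[OF bounded_bilinear_inner]

lemma higher_differentiable_on_diff:
  assumes "open S" "higher_differentiable_on S f n" "higher_differentiable_on S g n"
  shows "higher_differentiable_on S (\<lambda>x. f x - g x) n"
  using higher_differentiable_on_add[OF assms(1,2)
      higher_differentiable_on_scaleR[OF assms(1) higher_differentiable_on_const[of _ "-1"] assms(3)]]
  by simp

text \<open>In the chain rule the derivative of \<open>f\<close> acts on a vector that moves with
  \<open>x\<close>, whereas the recursive definition uses fixed directions. Expanding that vector in
  \<open>Basis\<close> leaves scalar coefficients times derivatives of \<open>f\<close> in fixed
  directions, to which the induction hypothesis applies.\<close>

lemma higher_differentiable_on_compose:
  fixes f :: "'a::euclidean_space \<Rightarrow> 'b::real_normed_vector"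
  assumes "open S" "u ` S \<subseteq> T"
  shows "higher_differentiable_on T f n \<Longrightarrow> higher_differentiable_on S u n \<Longrightarrow>
    higher_differentiable_on S (\<lambda>x. f (u x)) n"
proof (induction n arbitrary: f)
  case 0
  then show ?case using assms(2) by (auto intro: continuous_on_compose2)
next
  case (Suc n)
  note D = higher_differentiable_on_SucD[OF Suc.prems(1)] higher_differentiable_on_SucD[OF Suc.prems(2)]
  have D1: "((\<lambda>x. f (u x)) has_derivative
      (\<lambda>v. \<Sum>b\<in>Basis. (frechet_derivative u (at x) v \<bullet> b) *\<^sub>R frechet_derivative f (at (u x)) b)) (at x)"
    if "x \<in> S" for x
  proof -
    have fd: "(f has_derivative frechet_derivative f (at (u x))) (at (u x))"
      using D(1) that assms(2) by blast
    have "frechet_derivative f (at (u x)) w =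
        (\<Sum>b\<in>Basis. (w \<bullet> b) *\<^sub>R frechet_derivative f (at (u x)) b)" for w
      by (subst (1) euclidean_representation[of w, symmetric])
        (simp add: linear_sum linear_scale has_derivative_linear[OF fd])
    then show ?thesis
      by (intro has_derivative_eq_rhs[OF has_derivative_compose[OF D(3)[OF that] fd]] ext)
  qed
  have "higher_differentiable_on S (\<lambda>x. frechet_derivative f (at (u x)) b) n" for b
    by (rule Suc.IH[OF D(2) higher_differentiable_on_lower[OF Suc.prems(2)]])
  then show ?case
    by (intro higher_differentiable_on_SucI[OF assms(1) D1] higher_differentiable_on_sum
        higher_differentiable_on_scaleR higher_differentiable_on_inner
        higher_differentiable_on_const D assms(1) finite_Basis)
qed

lemma smooth_on_has_derivative:
  assumes "smooth_on S f" "x \<in> S"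
  shows "(f has_derivative frechet_derivative f (at x)) (at x)"
proof -
  have "higher_differentiable_on S f (Suc 0)" using assms(1) unfolding smooth_on_def by blast
  then show ?thesis using higher_differentiable_on_SucD(1) assms(2) by blast
qed

section \<open>A smooth bump function\<close>

text \<open>The parameter \<open>k\<close> makes the family closed under differentiation.\<close>

definition flat :: "nat \<Rightarrow> real \<Rightarrow> real" where
  "flat k t = (if t > 0 then exp (- inverse t) * inverse t ^ k else 0)"

text \<open>On the right, \<open>s = 1/t\<close> turns the limit into that of
  \<open>s ^ k / exp s\<close> at infinity; on the left the function is zero.\<close>

lemma flat_tendsto_0: "(flat k \<longlongrightarrow> 0) (at 0)"
proof -
  have "((\<lambda>s. s ^ k / exp s) \<longlongrightarrow> (0::real)) at_top"
    by (rule tendsto_power_div_exp_0)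
  from filterlim_compose[OF this filterlim_inverse_at_top_right]
  have "((\<lambda>t. inverse t ^ k / exp (inverse t)) \<longlongrightarrow> (0::real)) (at_right 0)" .
  then have "(flat k \<longlongrightarrow> 0) (at_right 0)"
    by (rule Lim_transform_eventually)
      (auto simp: eventually_at_right_less flat_def exp_minus field_simps eventually_at
        intro!: exI[of _ 1])
  moreover have "(flat k \<longlongrightarrow> 0) (at_left 0)"
    by (rule Lim_transform_eventually[OF tendsto_const])
      (auto simp: flat_def eventually_at intro!: exI[of _ 1])
  ultimately show ?thesis by (simp add: filterlim_split_at)
qed

lemma flat_has_real_derivative:
  "(flat k has_real_derivative (flat (k + 2) t - real k * flat (k + 1) t)) (at t)"
proof -
  consider "t > 0" | "t < 0" | "t = 0" by linarith
  then show ?thesis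
  proof cases
    case 1
    define s where "s = inverse t"
    have "((\<lambda>t. exp (- inverse t) * inverse t ^ k) has_real_derivative
        exp (- s) * s\<^sup>2 * s ^ k - exp (- s) * (real k * s ^ (k - 1) * s\<^sup>2)) (at t)"
      unfolding s_def power2_eq_square using 1 by (auto intro!: derivative_eq_intros)
    moreover have "exp (- s) * s\<^sup>2 * s ^ k - exp (- s) * (real k * s ^ (k - 1) * s\<^sup>2) =
        flat (k + 2) t - real k * flat (k + 1) t"
      using 1 unfolding flat_def s_def[symmetric]
      by (cases k) (simp_all add: power2_eq_square mult_ac)
    ultimately have "((\<lambda>t. exp (- inverse t) * inverse t ^ k) has_real_derivative
        flat (k + 2) t - real k * flat (k + 1) t) (at t)"
      by simp
    then show ?thesis
      by (rule has_field_derivative_transform_within_open[where S = "{0<..}"])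
        (use 1 in \<open>auto simp: flat_def\<close>)
  next
    case 2
    have "((\<lambda>t. 0) has_real_derivative (flat (k + 2) t - real k * flat (k + 1) t)) (at t)"
      using 2 by (auto simp: flat_def)
    then show ?thesis
      by (rule has_field_derivative_transform_within_open[where S = "{..<0}"])
        (use 2 in \<open>auto simp: flat_def\<close>)
  next
    case 3
    \<comment> \<open>Since \<open>flat k 0 = 0\<close>, dividing by \<open>h\<close> only adds one
      factor \<open>inverse h\<close>, so the difference quotient stays in the family.\<close>
    have "(\<lambda>h. (flat k (0 + h) - flat k 0) / h) = flat (Suc k)"
      by (auto simp: fun_eq_iff flat_def field_simps)
    then have "(flat k has_real_derivative 0) (at 0)"
      using flat_tendsto_0[of "Suc k"] by (simp only: DERIV_def)
    then show ?thesis using 3 by (simp add: flat_def)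
  qed
qed

lemma higher_differentiable_on_flat: "higher_differentiable_on UNIV (flat k) n"
proof (induction n arbitrary: k)
  case 0
  show ?case
    by (auto intro!: continuous_at_imp_continuous_on DERIV_isCont[OF flat_has_real_derivative])
next
  case (Suc n)
  show ?case
    by (rule higher_differentiable_on_SucI[OF open_UNIV
          flat_has_real_derivative[unfolded has_field_derivative_def]])
      (auto intro!: higher_differentiable_on_mult higher_differentiable_on_diff
        higher_differentiable_on_const Suc.IH)
qed

text \<open>This is exp(-1/(r^2 - |y - a|^2)) inside the ball and zero outside. The squared distance
  keeps it smooth at \<open>a\<close>.\<close>

definition bump :: "'a::euclidean_space \<Rightarrow> real \<Rightarrow> 'a \<Rightarrow> real" where
  "bump a r y = flat 0 (r\<^sup>2 - (y - a) \<bullet> (y - a))"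

lemma higher_differentiable_on_bump: "higher_differentiable_on UNIV (bump a r) n"
proof -
  have "higher_differentiable_on UNIV (\<lambda>y. r\<^sup>2 - (y - a) \<bullet> (y - a)) n"
    by (intro higher_differentiable_on_diff higher_differentiable_on_inner
      higher_differentiable_on_const higher_differentiable_on_id open_UNIV)
  from higher_differentiable_on_compose[OF open_UNIV subset_UNIV higher_differentiable_on_flat this]
  show ?thesis unfolding bump_def .
qed

lemma bump_eq_0:
  assumes "r > 0" "y \<notin> cball a r"
  shows "bump a r y = 0"
proof -
  have "r\<^sup>2 < (norm (y - a))\<^sup>2"
    using assms by (intro power_strict_mono) (auto simp: dist_norm norm_minus_commute)
  then show ?thesis by (simp add: bump_def flat_def power2_norm_eq_inner)
qed

lemma bump_center_ne_0: "r > 0 \<Longrightarrow> bump a r a \<noteq> 0"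
  by (simp add: bump_def flat_def)

text \<open>The peak value is positive and exp(-1/t) is injective for t > 0, so equality forces |y -
  a| = 0. A bump with a plateau would not single out its centre.\<close>

lemma bump_eq_centerD: "r > 0 \<Longrightarrow> bump a r y = bump a r a \<Longrightarrow> y = a"
  by (simp add: bump_def flat_def split: if_splits)

section \<open>Smooth functions and tangent vectors on manifolds\<close>

lemma smooth_manifoldD:
  assumes "smooth_manifold M"
  shows "(U, c) \<in> M \<Longrightarrow> chart U c"
    and "\<exists>U c. (U, c) \<in> M \<and> x \<in> U"
    and "(U, c) \<in> M \<Longrightarrow> (V, d) \<in> M \<Longrightarrow> smooth_on (c ` (U \<inter> V)) (d \<circ> inv_into U c)"
proof -
  have "x \<in> (\<Union>(U, c)\<in>M. U)" using assms by (simp add: smooth_manifold_def)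
  then show "\<exists>U c. (U, c) \<in> M \<and> x \<in> U" by auto
qed (use assms in \<open>unfold smooth_manifold_def, blast+\<close>)

lemma chartD:
  assumes "chart U c"
  shows "open U" "open (c ` U)" "continuous_on U c" "continuous_on (c ` U) (inv_into U c)"
    and "x \<in> U \<Longrightarrow> inv_into U c (c x) = x" "inj_on c U"
proof -
  show 1: "x \<in> U \<Longrightarrow> inv_into U c (c x) = x" for x
    using assms by (auto simp: chart_def homeomorphism_def)
  then show "inj_on c U" by (metis inj_onI)
qed (use assms in \<open>auto simp: chart_def homeomorphism_def\<close>)

lemma smooth_funI:
  assumes "\<And>U c n. (U, c) \<in> M \<Longrightarrow> higher_differentiable_on (c ` U) (\<lambda>y. f (inv_into U c y)) n"
  shows "smooth_fun M f"
  using assms unfolding smooth_fun_def smooth_on_def comp_def by blast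

lemma smooth_funD:
  assumes "smooth_fun M f" "(U, c) \<in> M"
  shows "higher_differentiable_on (c ` U) (\<lambda>y. f (inv_into U c y)) n"
  using assms unfolding smooth_fun_def smooth_on_def comp_def by blast

lemma open_chart_image: "smooth_manifold M \<Longrightarrow> (U, c) \<in> M \<Longrightarrow> open (c ` U)"
  by (rule chartD(2)[OF smooth_manifoldD(1)])

lemma smooth_fun_add:
  assumes "smooth_manifold M" "smooth_fun M f" "smooth_fun M g"
  shows "smooth_fun M (f + g)"
  unfolding plus_fun_def
  by (intro smooth_funI higher_differentiable_on_add smooth_funD[OF assms(2)]
      smooth_funD[OF assms(3)] open_chart_image[OF assms(1)])

lemma smooth_fun_scaleR:
  assumes "smooth_manifold M" "smooth_fun M f"
  shows "smooth_fun M (r *\<^sub>R f)"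
  unfolding scaleR_fun_def
  by (intro smooth_funI higher_differentiable_on_scaleR smooth_funD[OF assms(2)]
      higher_differentiable_on_const open_chart_image[OF assms(1)])

lemma smooth_fun_mult:
  assumes "smooth_manifold M" "smooth_fun M f" "smooth_fun M g"
  shows "smooth_fun M (f * g)"
  unfolding times_fun_def
  by (intro smooth_funI higher_differentiable_on_mult smooth_funD[OF assms(2)]
      smooth_funD[OF assms(3)] open_chart_image[OF assms(1)])

text \<open>Where \<open>F\<close> sends a piece of a chart of \<open>M\<close> into a chart
  \<open>(V, d)\<close> of \<open>N\<close>, the composite factors through \<open>d\<close>. By
  continuity of \<open>F\<close> these pieces are open, and they cover the chart.\<close>

lemma smooth_fun_compose:
  fixes M :: "('a::{t2_space, second_countable_topology}, 'e::euclidean_space) atlas"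
    and N :: "('b::{t2_space, second_countable_topology}, 'f::euclidean_space) atlas"
  assumes M: "smooth_manifold M" and N: "smooth_manifold N"
    and F: "smooth_map M N F" and h: "smooth_fun N h"
  shows "smooth_fun M (h \<circ> F)"
  unfolding smooth_fun_def smooth_on_def
proof (safe)
  fix U c n assume U: "(U, c) \<in> M"
  note C = chartD[OF smooth_manifoldD(1)[OF M U]]
  have "continuous_on (c ` U) (F \<circ> inv_into U c)"
    using F unfolding smooth_map_def
    by (meson C(4) continuous_on_compose continuous_on_subset subset_UNIV)
  then have op: "open (c ` U \<inter> (F \<circ> inv_into U c) -` V)" if "open V" for V
    using continuous_open_preimage C(2) that by blast
  have eq: "c ` (U \<inter> F -` V) = c ` U \<inter> (F \<circ> inv_into U c) -` V" for V
    by (auto simp: C(5))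
  have *: "open (c ` (U \<inter> F -` V)) \<and>
      higher_differentiable_on (c ` (U \<inter> F -` V)) (h \<circ> F \<circ> inv_into U c) n"
    if V: "(V, d) \<in> N" for V d
  proof
    note D = chartD[OF smooth_manifoldD(1)[OF N V]]
    show o: "open (c ` (U \<inter> F -` V))" using op[OF D(1)] eq by simp
    have 1: "higher_differentiable_on (c ` (U \<inter> F -` V)) (d \<circ> F \<circ> inv_into U c) n"
      using F U V unfolding smooth_map_def smooth_on_def by blast
    have 2: "higher_differentiable_on (d ` V) (h \<circ> inv_into V d) n"
      using smooth_funD[OF h V] by (simp add: comp_def)
    have 3: "(d \<circ> F \<circ> inv_into U c) ` (c ` (U \<inter> F -` V)) \<subseteq> d ` V"
      using C(5) by auto
    show "higher_differentiable_on (c ` (U \<inter> F -` V)) (h \<circ> F \<circ> inv_into U c) n"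
      using higher_differentiable_on_compose[OF o 3 2 1]
      by (rule higher_differentiable_on_cong[OF o, rotated]) (use C(5) D(5) in auto)
  qed
  have "higher_differentiable_on (\<Union>((\<lambda>(V, d). c ` (U \<inter> F -` V)) ` N)) (h \<circ> F \<circ> inv_into U c) n"
    by (rule higher_differentiable_on_Union) (use * in auto)
  moreover have "\<Union>((\<lambda>(V, d). c ` (U \<inter> F -` V)) ` N) = c ` U"
    using smooth_manifoldD(2)[OF N] by fastforce
  ultimately show "higher_differentiable_on (c ` U) (h \<circ> F \<circ> inv_into U c) n" by simp
qed

text \<open>The function vanishes off a compact \<open>K\<close> inside \<open>V\<close>, and
  \<open>K\<close> is closed since the space is Hausdorff. So \<open>V\<close> and the complement of
  \<open>K\<close> form an open cover, with a bump after a coordinate change on one member and zero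
  on the other.\<close>

lemma smooth_fun_bump:
  fixes N :: "('b::{t2_space, second_countable_topology}, 'f::euclidean_space) atlas"
  assumes N: "smooth_manifold N" and V: "(V, d) \<in> N" and r: "r > 0" "cball a r \<subseteq> d ` V"
  shows "smooth_fun N (\<lambda>y. if y \<in> V then bump a r (d y) else 0)" (is "smooth_fun N ?h")
  unfolding smooth_fun_def smooth_on_def
proof (safe)
  fix W e n assume W: "(W, e) \<in> N"
  note D = chartD[OF smooth_manifoldD(1)[OF N V]]
  note E = chartD[OF smooth_manifoldD(1)[OF N W]]
  define K where "K = inv_into V d ` cball a r"
  have "compact K" unfolding K_def
    by (intro compact_continuous_image compact_cball continuous_on_subset[OF D(4) r(2)])
  then have "closed K" by (rule compact_imp_closed)
  have h0: "bump a r (d y) = 0" if "y \<in> V" "y \<notin> K" for y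
  proof (rule bump_eq_0[OF r(1)])
    show "d y \<notin> cball a r"
      using imageI[of "d y" "cball a r" "inv_into V d"] that(2) unfolding K_def D(5)[OF that(1)]
      by blast
  qed
  have KV: "K \<subseteq> V" using r(2) by (auto simp: K_def intro!: inv_into_into)
  have op: "open (e ` W \<inter> inv_into W e -` T)" if "open T" for T
    using continuous_open_preimage[OF E(4) E(2) that] .
  have eq: "e ` (W \<inter> T) = e ` W \<inter> inv_into W e -` T" for T
    by (auto simp: E(5))
  let ?A = "e ` (W \<inter> V)" and ?B = "e ` (W \<inter> - K)"
  have oA: "open ?A" and oB: "open ?B"
    using op[OF D(1)] op[of "- K"] \<open>closed K\<close> eq by auto
  have "higher_differentiable_on ?A (d \<circ> inv_into W e) n"
    using smooth_manifoldD(3)[OF N W V] by (simp add: smooth_on_def)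
  from higher_differentiable_on_compose[OF oA _ higher_differentiable_on_bump this]
  have "higher_differentiable_on ?A (\<lambda>x. bump a r ((d \<circ> inv_into W e) x)) n" by simp
  then have "higher_differentiable_on ?A (?h \<circ> inv_into W e) n"
    by (rule higher_differentiable_on_cong[OF oA, rotated]) (use E(5) in auto)
  moreover have "higher_differentiable_on ?B (?h \<circ> inv_into W e) n"
    by (rule higher_differentiable_on_cong[OF oB _ higher_differentiable_on_const[of _ 0]])
      (auto simp: E(5) h0)
  ultimately have "higher_differentiable_on (\<Union>{?A, ?B}) (?h \<circ> inv_into W e) n"
    using oA oB by (intro higher_differentiable_on_Union) auto
  moreover have "\<Union>{?A, ?B} = e ` W" using KV by auto
  ultimately show "higher_differentiable_on (e ` W) (?h \<circ> inv_into W e) n" by simp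
qed

section \<open>Tangent vectors from charts, and the differential\<close>

definition chart_derivation ::
  "('a, 'e::euclidean_space) atlas \<Rightarrow> 'a set \<Rightarrow> ('a \<Rightarrow> 'e) \<Rightarrow> 'a \<Rightarrow> 'e \<Rightarrow> 'a tangent_vec" where
  "chart_derivation M U c x v f =
     (if smooth_fun M f then frechet_derivative (f \<circ> inv_into U c) (at (c x)) v else 0)"

lemma smooth_fun_has_derivative:
  assumes "smooth_fun M f" "(U, c) \<in> M" "y \<in> c ` U"
  shows "(f \<circ> inv_into U c has_derivative frechet_derivative (f \<circ> inv_into U c) (at y)) (at y)"
  using assms by (intro smooth_on_has_derivative) (auto simp: smooth_fun_def)

text \<open>Directional derivatives in a chart obey the sum, scalar and product rules; the value 0
  on non-smooth functions follows the convention of \<open>tangent_space\<close>.\<close>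

lemma chart_derivation_in_tangent_space:
  assumes M: "smooth_manifold M" and U: "(U, c) \<in> M" "x \<in> U"
  shows "chart_derivation M U c x v \<in> tangent_space M x"
proof -
  note D = smooth_fun_has_derivative[OF _ U(1) imageI[OF U(2)]]
  have x: "inv_into U c (c x) = x" using chartD(5) smooth_manifoldD(1)[OF M] U by blast
  have "frechet_derivative ((f + g) \<circ> inv_into U c) (at (c x)) v =
      frechet_derivative (f \<circ> inv_into U c) (at (c x)) v +
      frechet_derivative (g \<circ> inv_into U c) (at (c x)) v"
    if "smooth_fun M f" "smooth_fun M g" for f g
    using frechet_derivative_at[OF has_derivative_add[OF D[OF that(1)] D[OF that(2)]]]
    by (simp add: o_def fun_eq_iff)
  moreover have "frechet_derivative ((r *\<^sub>R f) \<circ> inv_into U c) (at (c x)) v =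
      r * frechet_derivative (f \<circ> inv_into U c) (at (c x)) v"
    if "smooth_fun M f" for f r
    using frechet_derivative_at[OF has_derivative_scaleR_right[OF D[OF that(1)], of r]]
    by (simp add: o_def fun_eq_iff scaleR_fun_def)
  moreover have "frechet_derivative ((f * g) \<circ> inv_into U c) (at (c x)) v =
      f x * frechet_derivative (g \<circ> inv_into U c) (at (c x)) v +
      g x * frechet_derivative (f \<circ> inv_into U c) (at (c x)) v"
    if "smooth_fun M f" "smooth_fun M g" for f g
    using frechet_derivative_at[OF has_derivative_mult[OF D[OF that(1)] D[OF that(2)]]]
    by (simp add: o_def fun_eq_iff x mult.commute)
  ultimately show ?thesis
    by (auto simp: tangent_space_def chart_derivation_def
        smooth_fun_add[OF M] smooth_fun_scaleR[OF M] smooth_fun_mult[OF M])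
qed

text \<open>Precomposition with \<open>F\<close> is an algebra homomorphism between the smooth
  functions, so derivations at \<open>x\<close> go to derivations at \<open>F x\<close>.\<close>

lemma differential_in_tangent_space:
  assumes M: "smooth_manifold M" and N: "smooth_manifold N" and F: "smooth_map M N F"
    and v: "v \<in> tangent_space M x"
  shows "differential N F v \<in> tangent_space N (F x)"
proof -
  note s = smooth_fun_compose[OF M N F]
  have "(f + g) \<circ> F = (f \<circ> F) + (g \<circ> F)" "(f * g) \<circ> F = (f \<circ> F) * (g \<circ> F)"
    "(r *\<^sub>R f) \<circ> F = r *\<^sub>R (f \<circ> F)" for f g :: "'c \<Rightarrow> real" and r
    by (auto simp: fun_eq_iff scaleR_fun_def)
  then show ?thesis
    using v s unfolding tangent_space_def differential_def
    by (auto simp: smooth_fun_add[OF N] smooth_fun_scaleR[OF N] smooth_fun_mult[OF N])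
qed

lemma differential_linear:
  "differential N F (a *\<^sub>R v + b *\<^sub>R w) = a *\<^sub>R differential N F v + b *\<^sub>R differential N F w"
  by (rule ext) (simp add: differential_def scaleR_fun_def plus_fun_def)

section \<open>Constancy from vanishing derivatives\<close>

lemma smooth_fun_constant_if_derivations_vanish:
  fixes M :: "('a::{t2_space, second_countable_topology}, 'e::euclidean_space) atlas"
  assumes conn: "connected (UNIV :: 'a set)" and M: "smooth_manifold M" and f: "smooth_fun M f"
    and 0: "\<And>x v. v \<in> tangent_space M x \<Longrightarrow> v f = 0"
  shows "f constant_on UNIV"
proof (rule locally_constant_imp_constant[OF conn])
  fix x :: 'a
  obtain U c where U: "(U, c) \<in> M" "x \<in> U" using smooth_manifoldD(2)[OF M] by blast
  note C = chartD[OF smooth_manifoldD(1)[OF M U(1)]]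
  obtain r where r: "r > 0" "ball (c x) r \<subseteq> c ` U"
    using C(2) U(2) by (meson imageI openE)
  \<comment> \<open>Applying the hypothesis to chart derivations at each point of the ball kills the
    whole derivative; convexity of the ball then gives local constancy.\<close>
  have D: "(f \<circ> inv_into U c has_derivative (\<lambda>v. 0)) (at y within ball (c x) r)"
    if y: "y \<in> ball (c x) r" for y
  proof -
    obtain z where z: "z \<in> U" "y = c z" using y r(2) by auto
    have "frechet_derivative (f \<circ> inv_into U c) (at y) v = 0" for v
      using 0[OF chart_derivation_in_tangent_space[OF M U(1) z(1), of v]] f z(2)
      by (simp add: chart_derivation_def)
    then have "frechet_derivative (f \<circ> inv_into U c) (at y) = (\<lambda>v. 0)" by blast
    then show ?thesis
      using smooth_fun_has_derivative[OF f U(1), of y] z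
      by (auto intro: has_derivative_at_withinI)
  qed
  have const: "(f \<circ> inv_into U c) y = f x" if "y \<in> ball (c x) r" for y
    using has_derivative_zero_unique[OF convex_ball D that, of "c x"] r(1) C(5)[OF U(2)]
    by simp
  show "\<exists>T. openin (top_of_set UNIV) T \<and> x \<in> T \<and> (\<forall>y\<in>T. f y = f x)"
  proof (intro exI conjI ballI)
    show "openin (top_of_set UNIV) (U \<inter> c -` ball (c x) r)"
      using continuous_open_preimage[OF C(3) C(1) open_ball] by simp
    show "x \<in> U \<inter> c -` ball (c x) r" using U r by simp
    show "f y = f x" if "y \<in> U \<inter> c -` ball (c x) r" for y
      using const[of "c y"] that C(5)[of y] by auto
  qed
qed

lemma constant_on_if_differential_vanishes:
  fixes M :: "('a::{t2_space, second_countable_topology}, 'e::euclidean_space) atlas"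
    and N :: "('b::{t2_space, second_countable_topology}, 'f::euclidean_space) atlas"
  assumes conn: "connected (UNIV :: 'a set)" and M: "smooth_manifold M" and N: "smooth_manifold N"
    and F: "smooth_map M N F"
    and 0: "\<And>x v. v \<in> tangent_space M x \<Longrightarrow> differential N F v = 0"
  shows "F constant_on UNIV"
proof -
  have "F x' = F x" for x x'
  proof -
    obtain V d where V: "(V, d) \<in> N" "F x \<in> V" using smooth_manifoldD(2)[OF N] by blast
    note D = chartD[OF smooth_manifoldD(1)[OF N V(1)]]
    obtain r where r: "r > 0" "cball (d (F x)) r \<subseteq> d ` V"
      using D(2) V(2) by (meson imageI open_contains_cball)
    define h where "h y = (if y \<in> V then bump (d (F x)) r (d y) else 0)" for y
    have h: "smooth_fun N h"
      unfolding h_def by (rule smooth_fun_bump[OF N V(1) r])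
    have "h \<circ> F constant_on UNIV"
    proof (rule smooth_fun_constant_if_derivations_vanish[OF conn M smooth_fun_compose[OF M N F h]])
      show "v (h \<circ> F) = 0" if "v \<in> tangent_space M y" for y v
        using fun_cong[OF 0[OF that], of h] h by (simp add: differential_def)
    qed
    then have "h (F x') = h (F x)" unfolding constant_on_def by (metis UNIV_I comp_apply)
    \<comment> \<open>\<open>h\<close> is zero off \<open>V\<close> but not at \<open>F x\<close>,
      so \<open>F x'\<close> lies in \<open>V\<close>; attaining the peak value, it has the
      coordinates of \<open>F x\<close>.\<close>
    then have "F x' \<in> V" "d (F x') = d (F x)"
      using V(2) bump_center_ne_0[OF r(1), of "d (F x)"] bump_eq_centerD[OF r(1)]
      by (auto simp: h_def split: if_splits)
    then show ?thesis using D(6) V(2) by (meson inj_onD)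
  qed
  then show ?thesis unfolding constant_on_def by blast
qed

section \<open>Algebra of the structure tensors\<close>

text \<open>To be applied with \<open>u\<close> the image of \<open>w\<close> under
  \<open>J\<close>, where \<open>J\<close> squares to -1 on \<open>w\<close>: the hypotheses are the
  metallic equation at \<open>w\<close> and at \<open>u\<close>. Eliminating \<open>u\<close> leaves
  a positive multiple of \<open>w\<close>.\<close>

lemma metallic_eq_0:
  fixes w u :: "'v::real_vector"
  assumes "- w = real p *\<^sub>R u + real q *\<^sub>R w" "- u = real p *\<^sub>R (- w) + real q *\<^sub>R u"
  shows "w = 0"
proof -
  have "(real p)\<^sup>2 + (real q + 1)\<^sup>2 \<noteq> 0"
    by (smt (verit) of_nat_0_le_iff zero_le_power2 zero_less_power)
  moreover have "((real p)\<^sup>2 + (real q + 1)\<^sup>2) *\<^sub>R w = 0"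
  proof -
    have 1: "(real q + 1) *\<^sub>R w = - (real p *\<^sub>R u)"
      using assms(1) by (simp add: scaleR_add_left eq_neg_iff_add_eq_0 neg_eq_iff_add_eq_0 ac_simps)
    have 2: "(real q + 1) *\<^sub>R u = real p *\<^sub>R w"
      using assms(2) by (simp add: scaleR_add_left neg_eq_iff_add_eq_0) (simp add: algebra_simps)
    have "(real q + 1)\<^sup>2 *\<^sub>R w = (real q + 1) *\<^sub>R ((real q + 1) *\<^sub>R w)"
      by (simp add: power2_eq_square)
    also have "\<dots> = - (real p *\<^sub>R ((real q + 1) *\<^sub>R u))"
      by (simp add: 1 mult.commute)
    also have "\<dots> = - ((real p)\<^sup>2 *\<^sub>R w)"
      by (simp add: 2 power2_eq_square)
    finally show ?thesis by (simp add: scaleR_add_left)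
  qed
  ultimately show ?thesis by simp
qed

theorem theorem4p9:
  fixes M :: "('a::{t2_space, second_countable_topology}, 'e::euclidean_space) atlas"
    and M\<^sub>1 :: "('b::{t2_space, second_countable_topology}, 'f::euclidean_space) atlas"
    and \<phi> :: "'a \<Rightarrow> 'a tangent_vec \<Rightarrow> 'a tangent_vec"
    and \<xi> :: "'a vec_field"
    and \<eta> :: "'a \<Rightarrow> 'a tangent_vec \<Rightarrow> real"
    and g :: "'a \<Rightarrow> 'a tangent_vec \<Rightarrow> 'a tangent_vec \<Rightarrow> real"
    and g\<^sub>1 :: "'b \<Rightarrow> 'b tangent_vec \<Rightarrow> 'b tangent_vec \<Rightarrow> real"
    and J\<^sub>1 :: "'b \<Rightarrow> 'b tangent_vec \<Rightarrow> 'b tangent_vec"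
    and F :: "'a \<Rightarrow> 'b"
  assumes "connected (UNIV :: 'a set)"
    and "almost_contact_metric_manifold M \<phi> \<xi> \<eta> g"
    and "metallic_riemannian_manifold M\<^sub>1 g\<^sub>1 J\<^sub>1"
    and "smooth_map M M\<^sub>1 F"
    and "\<forall>x. \<forall>v\<in>tangent_space M x.
           differential M\<^sub>1 F (\<phi> x v) = J\<^sub>1 (F x) (differential M\<^sub>1 F v)"
  shows "F constant_on UNIV"
proof (rule constant_on_if_differential_vanishes[OF assms(1) _ _ assms(4)])
  show M: "smooth_manifold M" and N: "smooth_manifold M\<^sub>1"
    using assms(2,3) by (auto simp: almost_contact_metric_manifold_def
        metallic_riemannian_manifold_def riemannian_manifold_def)
  obtain p q :: nat where pq: "p > 0" "q > 0"
    and J2: "\<And>y w. w \<in> tangent_space M\<^sub>1 y \<Longrightarrow>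
      J\<^sub>1 y (J\<^sub>1 y w) = real p *\<^sub>R J\<^sub>1 y w + real q *\<^sub>R w"
    and J: "tensor_field_1_1 M\<^sub>1 J\<^sub>1"
    using assms(3) by (auto simp: metallic_riemannian_manifold_def)
  have \<phi>: "\<And>x v. v \<in> tangent_space M x \<Longrightarrow> \<phi> x v \<in> tangent_space M x"
    and \<xi>: "\<And>x. \<xi> x \<in> tangent_space M x" "\<And>x. \<phi> x (\<xi> x) = 0"
    and \<phi>2: "\<And>x v. v \<in> tangent_space M x \<Longrightarrow> \<phi> x (\<phi> x v) = - v + \<eta> x v *\<^sub>R \<xi> x"
    using assms(2) by (auto simp: almost_contact_metric_manifold_def tensor_field_1_1_def
        smooth_vector_field_def)
  fix x v assume v: "v \<in> tangent_space M x"
  let ?D = "differential M\<^sub>1 F" and ?J = "J\<^sub>1 (F x)" and ?T = "tangent_space M\<^sub>1 (F x)"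
  have D: "?D u \<in> ?T" if "u \<in> tangent_space M x" for u
    using differential_in_tangent_space[OF M N assms(4) that] .
  have comm: "?D (\<phi> x u) = ?J (?D u)" if "u \<in> tangent_space M x" for u
    using assms(5) that by blast
  have Jlin: "?J (a *\<^sub>R u + b *\<^sub>R w) = a *\<^sub>R ?J u + b *\<^sub>R ?J w" if "u \<in> ?T" "w \<in> ?T" for a b u w
    using J that by (auto simp: tensor_field_1_1_def linear_on_tangent_def)
  have J0: "?J 0 = 0"
    using Jlin[OF D[OF v] D[OF v], of 0 0] by simp
  have D0: "?D 0 = 0" using differential_linear[of M\<^sub>1 F 0 v 0 v] by simp
  have "?J (?D (\<xi> x)) = 0" using comm[OF \<xi>(1)] \<xi>(2) D0 by simp
  \<comment> \<open>In the metallic equation at \<open>?D (\<xi> x)\<close> all terms but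
    \<open>q\<close> times this vector are now 0, and \<open>q > 0\<close>.\<close>
  then have D\<xi>: "?D (\<xi> x) = 0"
    using J2[OF D[OF \<xi>(1)]] J0 pq by simp
  have sq: "?J (?J (?D v)) = - ?D v"
  proof -
    have "?J (?J (?D v)) = ?D (\<phi> x (\<phi> x v))" using comm v \<phi> by simp
    \<comment> \<open>The factor -1 fits the form of \<open>differential_linear\<close>; the
      \<open>\<eta>\<close> term then dies with \<open>?D (\<xi> x)\<close>.\<close>
    also have "\<dots> = ?D ((-1) *\<^sub>R v + \<eta> x v *\<^sub>R \<xi> x)" using \<phi>2[OF v] by simp
    also have "\<dots> = - ?D v" by (simp only: differential_linear D\<xi>) simp
    finally show ?thesis .
  qed
  \<comment> \<open>Membership lets \<open>J2\<close> be used at \<open>?J (?D v)\<close>, which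
    gives the second equation for \<open>metallic_eq_0\<close>.\<close>
  have JD: "?J (?D v) \<in> ?T" using D[OF \<phi>[OF v]] comm[OF v] by simp
  have "?J (- ?D v) = - ?J (?D v)" using Jlin[OF D[OF v] D[OF v], of "-1" 0] by simp
  then show "?D v = 0"
    using metallic_eq_0[of "?D v" p "?J (?D v)" q] J2[OF D[OF v]] J2[OF JD] sq by simp
qed

end
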